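(* Let $P=\frac1{2^2}\delta_1+\frac12\delta_2+\sum_{j=3}^\infty\frac1{2^j}\delta_j$. The set $\{1,2,Av[3,4],Av[5,\infty)\}$ forms the optimal set of four-means for $P$ with quantization error $V_4(P)=\frac16$.
   Context: $\delta_x$ denotes the Dirac measure at $x\in\mathbb R$. For a Borel probability measure $P$ on $\mathbb R$ and a nonempty finite set $\alpha\subset\mathbb R$, the distortion error is $V(P;\alpha)=\int\min_{a\in\alpha}|x-a|^2\,dP(x)$. The $n$th quantization error is $V_n(P)=\inf\{V(P;\alpha):\alpha\subset\mathbb R,\ 1\le\mathrm{card}(\alpha)\le n\}$. An optimal set of $n$-means for $P$ is a set $\alpha$ with at most $n$ points for which this infimum is attained. With $p_m=P(\{m\})$ and $i\le\ell$ positive integers, $Av[i,\ell]=\frac{\sum_{m=i}^{\ell}p_m m}{\sum_{m=i}^{\ell}p_m}$ and $Av[i,\infty)=\frac{\sum_{m=i}^{\infty}p_m m}{\sum_{m=i}^{\infty}p_m}$. *)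

theory Defs
  imports "HOL-Probability.Probability"
begin

text \<open>
  The distortion error is an extended nonnegative real, so that it is \<infinity> (and not \<open>0\<close>, as with the
  Bochner integral) for a measure without second moment.
\<close>

definition distortion_error :: "real measure \<Rightarrow> real set \<Rightarrow> ennreal" where
  "distortion_error P \<alpha> = (\<integral>\<^sup>+x. ennreal (Min ((\<lambda>a. \<bar>x - a\<bar>\<^sup>2) ` \<alpha>)) \<partial>P)"

definition quantization_error :: "real measure \<Rightarrow> nat \<Rightarrow> ennreal" where
  "quantization_error P n =
     (INF \<alpha>\<in>{\<alpha>. finite \<alpha> \<and> 1 \<le> card \<alpha> \<and> card \<alpha> \<le> n}. distortion_error P \<alpha>)"

definition optimal_set_of_means :: "real measure \<Rightarrow> nat \<Rightarrow> real set \<Rightarrow> bool" where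
  "optimal_set_of_means P n \<alpha> \<longleftrightarrow>
     finite \<alpha> \<and> 1 \<le> card \<alpha> \<and> card \<alpha> \<le> n \<and> distortion_error P \<alpha> = quantization_error P n"

definition Av :: "real measure \<Rightarrow> nat \<Rightarrow> nat \<Rightarrow> real" where
  "Av P i l =
     (\<Sum>m=i..l. measure P {real m} * real m) / (\<Sum>m=i..l. measure P {real m})"

definition Av_inf :: "real measure \<Rightarrow> nat \<Rightarrow> real" where
  "Av_inf P i =
     (\<Sum>k. measure P {real (i + k)} * real (i + k)) / (\<Sum>k. measure P {real (i + k)})"

text \<open>\<open>return borel x\<close> is the Dirac measure at \<open>x\<close>; the series starts at \<open>j = k + 3\<close>.\<close>

definition dyadic_P :: "real measure" where
  "dyadic_P = measure_of UNIV (sets borel)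
     (\<lambda>A. ennreal (1 / 2 ^ 2) * emeasure (return borel 1) A
        + ennreal (1 / 2) * emeasure (return borel 2) A
        + (\<Sum>k. ennreal (1 / 2 ^ (k + 3)) * emeasure (return borel (real (k + 3))) A))"

lemma sets_dyadic_P: "sets dyadic_P = sets borel"
  unfolding dyadic_P_def using sets.sets_measure_of_eq[of "borel :: real measure"] by simp

text \<open>
  \<open>measure_of\<close> yields the null measure unless the given set function is countably additive,
  so this is needed for the definition above to mean what it says.
\<close>

lemma emeasure_dyadic_P:
  assumes "A \<in> sets borel"
  shows "emeasure dyadic_P A =
      ennreal (1 / 2 ^ 2) * emeasure (return borel 1) A
    + ennreal (1 / 2) * emeasure (return borel 2) A
    + (\<Sum>k. ennreal (1 / 2 ^ (k + 3)) * emeasure (return borel (real (k + 3))) A)"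
proof (rule emeasure_measure_of[OF dyadic_P_def])
  show "sets borel \<subseteq> Pow (UNIV :: real set)" by simp
  show "A \<in> sets dyadic_P" using assms by (simp add: sets_dyadic_P)
  show "positive (sets dyadic_P)
     (\<lambda>A. ennreal (1 / 2 ^ 2) * emeasure (return borel 1) A
        + ennreal (1 / 2) * emeasure (return borel 2) A
        + (\<Sum>k. ennreal (1 / 2 ^ (k + 3)) * emeasure (return borel (real (k + 3))) A))"
    by (simp add: positive_def)
  show "countably_additive (sets dyadic_P)
     (\<lambda>A. ennreal (1 / 2 ^ 2) * emeasure (return borel 1) A
        + ennreal (1 / 2) * emeasure (return borel 2) A
        + (\<Sum>k. ennreal (1 / 2 ^ (k + 3)) * emeasure (return borel (real (k + 3))) A))"
    unfolding sets_dyadic_P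
  proof (rule countably_additiveI)
    fix F :: "nat \<Rightarrow> real set"
    assume F: "range F \<subseteq> sets borel" "disjoint_family F"
    have u: "emeasure (return borel x) (\<Union>i. F i) = (\<Sum>i. emeasure (return borel x) (F i))"
      for x :: real
      using F by (intro suminf_emeasure[symmetric]) auto
    have swap: "(\<Sum>i. \<Sum>k. f i k) = (\<Sum>k. \<Sum>i. f i k)" for f :: "nat \<Rightarrow> nat \<Rightarrow> ennreal"
      using nn_integral_suminf[of "\<lambda>k i. f i k" "count_space UNIV"]
      by (simp add: nn_integral_count_space_nat)
    show "(\<Sum>i. ennreal (1 / 2 ^ 2) * emeasure (return borel 1) (F i)
        + ennreal (1 / 2) * emeasure (return borel 2) (F i)
        + (\<Sum>k. ennreal (1 / 2 ^ (k + 3)) * emeasure (return borel (real (k + 3))) (F i)))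
      = ennreal (1 / 2 ^ 2) * emeasure (return borel 1) (\<Union>i. F i)
        + ennreal (1 / 2) * emeasure (return borel 2) (\<Union>i. F i)
        + (\<Sum>k. ennreal (1 / 2 ^ (k + 3)) * emeasure (return borel (real (k + 3))) (\<Union>i. F i))"
      unfolding u
      by (simp only: suminf_add[OF summableI summableI, symmetric] ennreal_suminf_cmult
          swap[of "\<lambda>i k. ennreal (1 / 2 ^ (k + 3)) * emeasure (return borel (real (k + 3))) (F i)"])
  qed
qed

lemma prob_space_dyadic_P: "prob_space dyadic_P"
proof
  have s: "space dyadic_P = UNIV"
    using sets_eq_imp_space_eq[OF sets_dyadic_P] by simp
  have "(\<lambda>k. (1 / 8) * (1 / 2 :: real) ^ k) sums ((1 / 8) * (1 / (1 - 1 / 2)))"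
    by (intro sums_mult geometric_sums) simp
  then have "(\<lambda>k. 1 / 2 ^ (k + 3) :: real) sums (1 / 4)"
    by (simp add: power_add power_divide mult.commute)
  then have "(\<Sum>k. ennreal (1 / 2 ^ (k + 3))) = ennreal (1 / 4)"
    by (intro suminf_ennreal_eq) auto
  then have "emeasure dyadic_P UNIV = ennreal (1 / 4) + ennreal (1 / 2) + ennreal (1 / 4)"
    by (subst emeasure_dyadic_P) (simp_all add: emeasure_return)
  also have "\<dots> = 1"
    by (subst ennreal_plus[symmetric], simp, simp)+ simp
  finally show "emeasure dyadic_P (space dyadic_P) = 1"
    by (simp add: s)
qed

end

theory Submission
  imports Defs "HOL-Real_Asymp.Real_Asymp"
begin

text \<open>
  Send the atom \<open>j\<close> to a nearest point of \<open>\<alpha>\<close>. This assignment is monotone, so its fibres are at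
  most four intervals of integers. Merging \<open>1\<close> and \<open>2\<close> costs \<open>1/6\<close>, and the other atoms cannot all be
  free. Merging \<open>2, 3, 4\<close> costs \<open>25/88\<close>. Merging only \<open>2\<close> and \<open>3\<close> costs \<open>1/10\<close>, and the atoms from
  \<open>4\<close> on then share two points, at a cost of at least \<open>1/12\<close>. Otherwise the atoms from \<open>3\<close> on share
  two points. By self-similarity of the geometric tail, both tails reduce to the two-means problem
  for the weights \<open>1/2^k\<close> at \<open>k = 0, 1, \<dots>\<close>, whose minimum \<open>4/3\<close> is attained only by \<open>{1/3, 3}\<close>.
\<close>

section \<open>Two means for the geometric weights\<close>

text \<open>The weights \<open>1 / 2 ^ k\<close> have total mass \<open>2\<close> and mean
  \<open>1\<close>, so moving the centre from \<open>1\<close> to \<open>c\<close> adds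
  \<open>2 * (1 - c)\<^sup>2\<close> to the second moment \<open>4\<close> about the mean.\<close>

lemma geometric_second_moment_sums:
  fixes c :: real
  shows "(\<lambda>k. (real k - c)\<^sup>2 / 2 ^ k) sums (4 + 2 * (1 - c)\<^sup>2)"
proof -
  \<comment> \<open>\<open>q k\<close> is minus the tail of the series from index \<open>k\<close>
    on, so its increments are the terms of the series.\<close>
  define q where "q k = - (2 * (real k - c)\<^sup>2 + 4 * (real k - c) + 6) / 2 ^ k" for k :: nat
  have "q \<longlonglongrightarrow> 0"
    unfolding q_def by real_asymp
  then have "(\<lambda>k. q (Suc k) - q k) sums (0 - q 0)"
    by (rule telescope_sums)
  moreover have "q (Suc k) - q k = (real k - c)\<^sup>2 / 2 ^ k" for k
    by (simp add: q_def field_simps power2_eq_square)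
  moreover have "0 - q 0 = 4 + 2 * (1 - c)\<^sup>2"
    by (simp add: q_def algebra_simps power2_eq_square)
  ultimately show ?thesis
    by simp
qed

lemma geometric_first_moment_sums: "(\<lambda>k. real k / 2 ^ k) sums 2"
proof -
  define q where "q k = - (2 * real k + 2) / 2 ^ k" for k :: nat
  have "q \<longlonglongrightarrow> 0"
    unfolding q_def by real_asymp
  then have "(\<lambda>k. q (Suc k) - q k) sums (0 - q 0)"
    by (rule telescope_sums)
  moreover have "q (Suc k) - q k = real k / 2 ^ k" for k
    by (simp add: q_def field_simps)
  ultimately show ?thesis
    by (simp add: q_def)
qed

lemma geometric_half_sums: "(\<lambda>k. 1 / 2 ^ k :: real) sums 2"
  using geometric_sums[of "1 / 2 :: real"] by (simp add: power_divide)

text \<open>Self-similarity: after a shift by \<open>m\<close> the weights are the same up to the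
  factor \<open>1 / 2 ^ m\<close> and the centre becomes \<open>c - m\<close>, so the tail is a full
  second moment again.\<close>

lemma geometric_cost_eventually_const:
  fixes M :: "nat \<Rightarrow> real"
  assumes S: "(\<lambda>k. (real k - M k)\<^sup>2 / 2 ^ k) sums S"
    and const: "\<And>k. k \<ge> m \<Longrightarrow> M k = c"
  shows "S = (\<Sum>k<m. (real k - M k)\<^sup>2 / 2 ^ k) + (4 + 2 * (real m + 1 - c)\<^sup>2) / 2 ^ m"
proof -
  have "(\<lambda>k. (real k - (c - real m))\<^sup>2 / 2 ^ k / 2 ^ m) sums ((4 + 2 * (1 - (c - real m))\<^sup>2) / 2 ^ m)"
    by (intro sums_divide geometric_second_moment_sums)
  moreover have "(real k - (c - real m))\<^sup>2 / 2 ^ k / 2 ^ m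
      = (real (k + m) - M (k + m))\<^sup>2 / 2 ^ (k + m)" for k
    by (simp add: const power_add algebra_simps)
  ultimately have "(\<lambda>k. (real (k + m) - M (k + m))\<^sup>2 / 2 ^ (k + m)) sums
      ((4 + 2 * (1 - (c - real m))\<^sup>2) / 2 ^ m)"
    by simp
  then have "(\<lambda>k. (real k - M k)\<^sup>2 / 2 ^ k) sums
      ((4 + 2 * (1 - (c - real m))\<^sup>2) / 2 ^ m + (\<Sum>k<m. (real k - M k)\<^sup>2 / 2 ^ k))"
    by (subst (asm) sums_iff_shift)
  with S show ?thesis
    by (auto dest: sums_unique2 simp: algebra_simps)
qed

lemma mono_two_values_eventually_const:
  fixes M :: "nat \<Rightarrow> real"
  assumes M: "mono M" "finite (range M)" "card (range M) \<le> 2"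
    and ij: "i \<le> j" "M i \<noteq> M j" and k: "k \<ge> j"
  shows "M k = M j"
proof (rule ccontr)
  assume ne: "M k \<noteq> M j"
  have "M i \<le> M j" "M j \<le> M k"
    using M(1) ij k by (auto dest: monoD)
  then have "card {M i, M j, M k} = 3"
    using ne ij by auto
  moreover have "card {M i, M j, M k} \<le> card (range M)"
    by (intro card_mono M) auto
  ultimately show False
    using M(3) by simp
qed

text \<open>The cases follow the first index at which \<open>M\<close> leaves the value
  \<open>M 0\<close>. A jump at \<open>1\<close>, \<open>2\<close> or \<open>3\<close> costs at
  least \<open>2\<close>, \<open>4 / 3\<close> or \<open>10 / 7\<close>. With a later jump or none,
  the first four atoms share a point and alone cost \<open>97 / 60\<close>.\<close>

lemma geometric_two_means:
  fixes M :: "nat \<Rightarrow> real"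
  assumes M: "mono M" "finite (range M)" "card (range M) \<le> 2"
    and S: "(\<lambda>k. (real k - M k)\<^sup>2 / 2 ^ k) sums S"
  shows "4 / 3 \<le> S" and "S \<le> 4 / 3 \<Longrightarrow> M 0 = 1 / 3 \<and> M 2 = 3"
proof -
  have between: "M i = M 0" if "M 0 = M j" "i \<le> j" for i j
    using that M(1) by (metis antisym le0 monoD)
  have const: "S = (\<Sum>k<m. (real k - M k)\<^sup>2 / 2 ^ k) + (4 + 2 * (real m + 1 - M m)\<^sup>2) / 2 ^ m"
    if "M 0 \<noteq> M m" for m
    by (rule geometric_cost_eventually_const[OF S])
      (rule mono_two_values_eventually_const[OF M le0 that])
  consider "M 0 \<noteq> M 1" | "M 0 = M 1" "M 0 \<noteq> M 2" | "M 0 = M 2" "M 0 \<noteq> M 3" | "M 0 = M 3"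
    by blast
  then have "4 / 3 \<le> S \<and> (S \<le> 4 / 3 \<longrightarrow> M 0 = 1 / 3 \<and> M 2 = 3)"
  proof cases
    case 1
    have "S = (M 0)\<^sup>2 + 2 + (2 - M 1)\<^sup>2"
      using const[of 1] 1 by (simp add: field_simps)
    then have "S \<ge> 2"
      by simp
    then show ?thesis
      by simp
  next
    case 2
    have "S = (M 0)\<^sup>2 + (1 - M 0)\<^sup>2 / 2 + (4 + 2 * (3 - M 2)\<^sup>2) / 4"
      using const[of 2] 2 by (simp add: eval_nat_numeral)
    \<comment> \<open>Completing squares shows the block means: \<open>1 / 3\<close> for the atoms
      \<open>0, 1\<close> and \<open>3\<close> for the tail from \<open>2\<close>.\<close>
    also have "\<dots> = 4 / 3 + 3 / 2 * (M 0 - 1 / 3)\<^sup>2 + (M 2 - 3)\<^sup>2 / 2"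
      by (simp add: field_simps power2_eq_square)
    finally have eq: "S = 4 / 3 + 3 / 2 * (M 0 - 1 / 3)\<^sup>2 + (M 2 - 3)\<^sup>2 / 2" .
    have nn: "(M 0 - 1 / 3)\<^sup>2 \<ge> 0" "(M 2 - 3)\<^sup>2 \<ge> 0"
      by simp_all
    have "M 0 = 1 / 3 \<and> M 2 = 3" if "S \<le> 4 / 3"
    proof -
      have "(M 0 - 1 / 3)\<^sup>2 = 0 \<and> (M 2 - 3)\<^sup>2 = 0"
        using that eq nn by linarith
      then show ?thesis
        by simp
    qed
    moreover have "4 / 3 \<le> S"
      using eq nn by linarith
    ultimately show ?thesis
      by blast
  next
    case 3
    have "S = (M 0)\<^sup>2 + (1 - M 0)\<^sup>2 / 2 + (2 - M 0)\<^sup>2 / 4 + (4 + 2 * (4 - M 3)\<^sup>2) / 8"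
      using const[of 3] 3 between[of 2 1] by (simp add: eval_nat_numeral)
    also have "\<dots> = 10 / 7 + 7 / 4 * (M 0 - 4 / 7)\<^sup>2 + (M 3 - 4)\<^sup>2 / 4"
      by (simp add: field_simps power2_eq_square)
    finally have "S \<ge> 10 / 7"
      by (simp add: add_increasing2)
    then show ?thesis
      by simp
  next
    case 4
    have "(\<Sum>k<4. (real k - M k)\<^sup>2 / 2 ^ k) \<le> S"
      using sum_le_suminf[of _ "{..<4}", OF sums_summable[OF S]] sums_unique[OF S] by simp
    also have "(\<Sum>k<4. (real k - M k)\<^sup>2 / 2 ^ k)
        = (M 0)\<^sup>2 + (1 - M 0)\<^sup>2 / 2 + (2 - M 0)\<^sup>2 / 4 + (3 - M 0)\<^sup>2 / 8"
      using 4 between[of 3 1] between[of 3 2] by (simp add: eval_nat_numeral)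
    also have "\<dots> = 97 / 60 + 15 / 8 * (M 0 - 11 / 15)\<^sup>2"
      by (simp add: field_simps power2_eq_square)
    finally have "S \<ge> 97 / 60"
      using zero_le_power2[of "M 0 - 11 / 15"] by linarith
    then show ?thesis
      by simp
  qed
  then show "4 / 3 \<le> S" and "S \<le> 4 / 3 \<Longrightarrow> M 0 = 1 / 3 \<and> M 2 = 3"
    by auto
qed

section \<open>Monotone assignments with four values\<close>

text \<open>\<open>atom_mass k\<close> is the mass of the atom at \<open>k + 1\<close>.\<close>

definition atom_mass :: "nat \<Rightarrow> real" where
  "atom_mass k = (if k = 0 then 1 / 4 else if k = 1 then 1 / 2 else 1 / 2 ^ (k + 1))"

lemma atom_mass_pos: "atom_mass k > 0"
  by (simp add: atom_mass_def)

lemma atom_mass_add: "m \<ge> 2 \<Longrightarrow> atom_mass (k + m) = 1 / 2 ^ (m + 1) / 2 ^ k"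
  by (simp add: atom_mass_def power_add)

text \<open>From index \<open>2\<close> on the masses are geometric. Translating the atom at
  \<open>m + 1\<close> to \<open>0\<close> and scaling its mass \<open>1 / 2 ^ (m + 1)\<close> to
  \<open>1\<close> turns the tail into the two-means problem, with cost \<open>T\<close>.\<close>

lemma assignment_tail_cost:
  fixes N :: "nat \<Rightarrow> real"
  assumes N: "mono N" "finite (N ` {m..})" "card (N ` {m..}) \<le> 2" and m: "m \<ge> 2"
    and S: "(\<lambda>k. atom_mass k * (real k + 1 - N k)\<^sup>2) sums S"
  defines "T \<equiv> 2 ^ (m + 1) * (S - (\<Sum>k<m. atom_mass k * (real k + 1 - N k)\<^sup>2))"
  shows "4 / 3 \<le> T"
    and "T \<le> 4 / 3 \<Longrightarrow> N m = real m + 4 / 3 \<and> N (m + 2) = real m + 4"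
proof -
  define M where "M k = N (k + m) - (real m + 1)" for k
  have "range M = (\<lambda>x. x - (real m + 1)) ` N ` {m..}"
  proof -
    have "{m..} = range (\<lambda>k. k + m)"
      by (auto simp: image_iff) (metis add.commute le_Suc_ex)
    then show ?thesis
      by (auto simp: M_def image_iff)
  qed
  then have "finite (range M)" "card (range M) \<le> 2"
    using N card_image_le[of "N ` {m..}" "\<lambda>x. x - (real m + 1)"] by auto
  moreover have "mono M"
    using N(1) by (auto simp: M_def mono_def)
  moreover have "(\<lambda>k. (real k - M k)\<^sup>2 / 2 ^ k) sums T"
  proof -
    have "(\<lambda>k. 2 ^ (m + 1) * (atom_mass (k + m) * (real (k + m) + 1 - N (k + m))\<^sup>2)) sums T"
      unfolding T_def
      using sums_mult[OF sums_split_initial_segment[OF S, of m], of "2 ^ (m + 1)"] by simp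
    moreover have "2 ^ (m + 1) * (atom_mass (k + m) * (real (k + m) + 1 - N (k + m))\<^sup>2)
        = (real k - M k)\<^sup>2 / 2 ^ k" for k
      using m by (simp add: atom_mass_add M_def algebra_simps)
    ultimately show ?thesis
      by simp
  qed
  ultimately show "4 / 3 \<le> T"
    and "T \<le> 4 / 3 \<Longrightarrow> N m = real m + 4 / 3 \<and> N (m + 2) = real m + 4"
    using geometric_two_means[of M T] by (auto simp: M_def add.commute)
qed

text \<open>The cases record which of the first four atoms share a value. Only the last one, with
  \<open>1\<close> and \<open>2\<close> separated from each other and from the rest, attains
  \<open>1 / 6\<close>.\<close>

lemma assignment_cost:
  fixes N :: "nat \<Rightarrow> real"
  assumes N: "mono N" "finite (range N)" "card (range N) \<le> 4"
    and S: "(\<lambda>k. atom_mass k * (real k + 1 - N k)\<^sup>2) sums S"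
  shows "1 / 6 \<le> S \<and> (S \<le> 1 / 6 \<longrightarrow> {1, 2, 10 / 3, 6} \<subseteq> range N)"
proof -
  have partial: "(\<Sum>k\<in>F. atom_mass k * (real k + 1 - N k)\<^sup>2) \<le> S" if "finite F" for F
    using sum_le_suminf[OF sums_summable[OF S] that] sums_unique[OF S]
    by (simp add: atom_mass_pos less_imp_le)
  \<comment> \<open>By monotonicity the values \<open>N 0\<close> and \<open>N 1\<close> cannot
    recur from \<open>m\<close> on, so at most two of the four remain.\<close>
  have tail: "finite (N ` {m..})" "card (N ` {m..}) \<le> 2" if "N 0 < N 1" "N 1 < N m" for m
  proof -
    have sub: "N ` {m..} \<subseteq> range N - {N 0, N 1}"
      using that N(1) by (force dest: monoD)
    then show "finite (N ` {m..})"
      using N(2) finite_subset by blast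
    have "card (range N - {N 0, N 1}) = card (range N) - 2"
      using that N(2) by (subst card_Diff_subset) auto
    then show "card (N ` {m..}) \<le> 2"
      using card_mono[OF _ sub] N by simp
  qed
  have le: "N 0 \<le> N 1" "N 1 \<le> N 2" "N 2 \<le> N 3"
    by (simp_all add: monoD[OF N(1)])
  consider "N 0 = N 1" | "N 0 < N 1" "N 1 = N 3" | "N 0 < N 1" "N 1 = N 2" "N 2 < N 3"
    | "N 0 < N 1" "N 1 < N 2"
    using le by argo
  then show ?thesis
  proof cases
    case 1
    \<comment> \<open>Finitely many values cannot match infinitely many atoms exactly. The extra
      positive cost at \<open>j\<close> excludes equality with \<open>1 / 6\<close>.\<close>
    obtain j where j: "j \<ge> 2" "N j \<noteq> real j + 1"
    proof -
      have "infinite ((\<lambda>j. real j + 1) ` {2..})"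
        by (subst finite_image_iff) (auto simp: inj_on_def infinite_Ici)
      then have "\<not> (\<lambda>j. real j + 1) ` {2..} \<subseteq> range N"
        using N(2) finite_subset by blast
      then obtain j where "j \<ge> 2" "real j + 1 \<notin> range N"
        by auto
      then show ?thesis
        using that by (metis rangeI)
    qed
    have "(1 - N 0)\<^sup>2 / 4 + (2 - N 0)\<^sup>2 / 2 + atom_mass j * (real j + 1 - N j)\<^sup>2 \<le> S"
      using partial[of "{0, 1, j}"] j 1 by (simp add: atom_mass_def)
    moreover have "(1 - N 0)\<^sup>2 / 4 + (2 - N 0)\<^sup>2 / 2 = 1 / 6 + 3 / 4 * (N 0 - 5 / 3)\<^sup>2"
      by (simp add: field_simps power2_eq_square)
    moreover have "atom_mass j * (real j + 1 - N j)\<^sup>2 > 0"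
      using j by (simp add: atom_mass_pos)
    ultimately have "S > 1 / 6"
      using zero_le_power2[of "N 0 - 5 / 3"] by linarith
    then show ?thesis
      by simp
  next
    case 2
    then have "N 1 = N 2"
      using le by simp
    with 2 have "(2 - N 1)\<^sup>2 / 2 + (3 - N 1)\<^sup>2 / 8 + (4 - N 1)\<^sup>2 / 16 \<le> S"
      using partial[of "{1, 2, 3}"] by (simp add: atom_mass_def)
    moreover have "(2 - N 1)\<^sup>2 / 2 + (3 - N 1)\<^sup>2 / 8 + (4 - N 1)\<^sup>2 / 16
        = 25 / 88 + 11 / 16 * (N 1 - 26 / 11)\<^sup>2"
      by (simp add: field_simps power2_eq_square)
    ultimately have "S \<ge> 25 / 88"
      using zero_le_power2[of "N 1 - 26 / 11"] by linarith
    then show ?thesis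
      by simp
  next
    case 3
    then have "N 1 < N 3"
      by simp
    \<comment> \<open>Here \<open>m = 3\<close>, and the bound for the tail is
      \<open>(4 / 3) / 2 ^ 4 = 1 / 12\<close>.\<close>
    from assignment_tail_cost(1)[OF N(1) tail[OF 3(1) this] _ S]
    have "1 / 12 \<le> S - ((1 - N 0)\<^sup>2 / 4 + (2 - N 1)\<^sup>2 / 2 + (3 - N 1)\<^sup>2 / 8)"
      using 3 by (simp add: eval_nat_numeral atom_mass_def)
    moreover have "(2 - N 1)\<^sup>2 / 2 + (3 - N 1)\<^sup>2 / 8 = 1 / 10 + 5 / 8 * (N 1 - 11 / 5)\<^sup>2"
      by (simp add: field_simps power2_eq_square)
    ultimately have "S \<ge> 1 / 12 + 1 / 10"
      using zero_le_power2[of "1 - N 0"] zero_le_power2[of "N 1 - 11 / 5"] by linarith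
    then show ?thesis
      by simp
  next
    case 4
    \<comment> \<open>With \<open>m = 2\<close> the tail costs at least
      \<open>(4 / 3) / 2 ^ 3 = 1 / 6\<close>. If \<open>S \<le> 1 / 6\<close>, nothing is left for
      the atoms \<open>1\<close> and \<open>2\<close>, and the tail must be optimal.\<close>
    note cost = assignment_tail_cost[OF N(1) tail[OF 4] order_refl S]
    have *: "(\<Sum>k<2. atom_mass k * (real k + 1 - N k)\<^sup>2) = (1 - N 0)\<^sup>2 / 4 + (2 - N 1)\<^sup>2 / 2"
      by (simp add: eval_nat_numeral atom_mass_def)
    have ge: "1 / 6 \<le> S - ((1 - N 0)\<^sup>2 / 4 + (2 - N 1)\<^sup>2 / 2)"
      using cost(1) unfolding * by simp
    have nn: "(1 - N 0)\<^sup>2 \<ge> 0" "(2 - N 1)\<^sup>2 \<ge> 0"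
      by simp_all
    have "{1, 2, 10 / 3, 6} \<subseteq> range N" if "S \<le> 1 / 6"
    proof -
      have "S - ((1 - N 0)\<^sup>2 / 4 + (2 - N 1)\<^sup>2 / 2) \<le> 1 / 6"
        using that nn by linarith
      then have "2 ^ (2 + 1) * (S - ((1 - N 0)\<^sup>2 / 4 + (2 - N 1)\<^sup>2 / 2)) \<le> 4 / 3"
        by simp
      then have "N 2 = 10 / 3" "N 4 = 6"
        using cost(2) unfolding * by simp_all
      moreover have "(1 - N 0)\<^sup>2 = 0 \<and> (2 - N 1)\<^sup>2 = 0"
        using ge that nn by linarith
      then have "N 0 = 1" "N 1 = 2"
        by simp_all
      ultimately show ?thesis
        by (metis empty_subsetI insert_subset rangeI)
    qed
    moreover have "1 / 6 \<le> S"
      using ge nn by linarith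
    ultimately show ?thesis
      by blast
  qed
qed

section \<open>The measure as an image of a weighted counting measure\<close>

text \<open>This form turns integrals into series over the atoms, with index \<open>k\<close>
  standing for the atom \<open>k + 1\<close>.\<close>

lemma dyadic_P_eq_distr:
  "dyadic_P = distr (density (count_space UNIV) (\<lambda>k. ennreal (atom_mass k))) borel (\<lambda>k. real k + 1)"
    (is "_ = ?D")
proof (rule measure_eqI)
  show "sets dyadic_P = sets ?D"
    by (simp add: sets_dyadic_P)
  fix A assume "A \<in> sets dyadic_P"
  then have A: "A \<in> sets borel"
    by (simp add: sets_dyadic_P)
  define f where "f k = ennreal (atom_mass k) * indicator A (real k + 1)" for k
  have "emeasure ?D A = (\<Sum>k. f k)"
    using A by (simp add: emeasure_distr emeasure_density nn_integral_count_space_nat f_def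
        indicator_def cong: if_cong)
  also have "\<dots> = (\<Sum>k. f (k + 2)) + (\<Sum>k<2. f k)"
    by (rule suminf_offset) simp
  also have "(\<Sum>k<2. f k) = f 0 + f 1"
    by (simp add: eval_nat_numeral)
  also have "(\<lambda>k. f (k + 2))
      = (\<lambda>k. ennreal (1 / 2 ^ (k + 3)) * emeasure (return borel (real (k + 3))) A)"
    using A by (simp add: fun_eq_iff f_def atom_mass_def eval_nat_numeral add.commute)
  also have "f 0 + f 1 = ennreal (1 / 2 ^ 2) * emeasure (return borel 1) A
      + ennreal (1 / 2) * emeasure (return borel 2) A"
    using A by (simp add: f_def atom_mass_def)
  finally show "emeasure dyadic_P A = emeasure ?D A"
    using A by (simp add: emeasure_dyadic_P add.commute)
qed

lemma nn_integral_dyadic_P: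
  assumes "f \<in> borel_measurable borel"
  shows "(\<integral>\<^sup>+x. f x \<partial>dyadic_P) = (\<Sum>k. ennreal (atom_mass k) * f (real k + 1))"
  using assms unfolding dyadic_P_eq_distr
  by (simp add: nn_integral_distr nn_integral_density nn_integral_count_space_nat)

lemma measure_dyadic_P_singleton: "measure dyadic_P {real (Suc k)} = atom_mass k"
proof -
  have "(\<lambda>j. real j + 1) -` {real (Suc k)} = {k}"
    by auto
  then have "emeasure dyadic_P {real (Suc k)} = ennreal (atom_mass k)"
    unfolding dyadic_P_eq_distr
    by (simp add: emeasure_distr emeasure_density)
  then show ?thesis
    by (simp add: measure_def atom_mass_pos less_imp_le)
qed

lemma Av_dyadic_P_3_4: "Av dyadic_P 3 4 = 10 / 3"
proof -
  have p: "measure dyadic_P {3} = 1 / 8" "measure dyadic_P {4} = 1 / 16"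
    using measure_dyadic_P_singleton[of 2] measure_dyadic_P_singleton[of 3]
    by (simp_all add: atom_mass_def)
  have "{3..4} = {3, 4 :: nat}"
    by auto
  then show ?thesis
    by (simp add: Av_def p)
qed

lemma Av_inf_dyadic_P_5: "Av_inf dyadic_P 5 = 6"
proof -
  have p: "measure dyadic_P {real (5 + k)} = 1 / 2 ^ k / 32" for k
    using measure_dyadic_P_singleton[of "k + 4"] atom_mass_add[of 4 k]
    by (simp add: add.commute)
  have "(\<lambda>k. 1 / 2 ^ k / 32 :: real) sums (2 / 32)"
    by (intro sums_divide geometric_half_sums)
  moreover have "(\<lambda>k. (real k / 2 ^ k + 5 * (1 / 2 ^ k)) / 32) sums ((2 + 5 * 2) / 32)"
    by (intro sums_divide sums_add sums_mult geometric_first_moment_sums geometric_half_sums)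
  then have "(\<lambda>k. 1 / 2 ^ k / 32 * real (5 + k)) sums (12 / 32)"
    by (simp add: field_simps)
  ultimately show ?thesis
    unfolding Av_inf_def p by (simp add: sums_unique[symmetric] del: of_nat_add)
qed

section \<open>The distortion error\<close>

lemma distortion_error_dyadic_P:
  assumes "finite \<alpha>"
  shows "distortion_error dyadic_P \<alpha>
    = (\<Sum>k. ennreal (atom_mass k) * ennreal (Min ((\<lambda>a. \<bar>real k + 1 - a\<bar>\<^sup>2) ` \<alpha>)))"
  unfolding distortion_error_def
  using assms by (intro nn_integral_dyadic_P measurable_compose[OF _ measurable_ennreal]
      borel_measurable_Min) auto

text \<open>Exchange argument: if \<open>u > v\<close>, swapping the two points would lower the
  total cost by \<open>2 * (u - v) * (y - x) > 0\<close>, although neither single swap lowers its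
  own term.\<close>

lemma nearest_point_mono:
  fixes u v x y :: real
  assumes "x \<le> y" "(x - u)\<^sup>2 \<le> (x - v)\<^sup>2" "(y - v)\<^sup>2 \<le> (y - u)\<^sup>2" "x \<noteq> y"
  shows "u \<le> v"
proof (rule ccontr)
  assume "\<not> u \<le> v"
  then have "(u - v) * (y - x) > 0"
    using assms by simp
  moreover have "2 * ((u - v) * (y - x))
      = ((x - u)\<^sup>2 - (x - v)\<^sup>2) + ((y - v)\<^sup>2 - (y - u)\<^sup>2)"
    by (simp add: algebra_simps power2_eq_square)
  ultimately show False
    using assms by linarith
qed

lemma distortion_error_lower_bound:
  assumes \<alpha>: "finite \<alpha>" "1 \<le> card \<alpha>" "card \<alpha> \<le> 4"
  shows "ennreal (1 / 6) \<le> distortion_error dyadic_P \<alpha>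
    \<and> (distortion_error dyadic_P \<alpha> \<le> ennreal (1 / 6) \<longrightarrow> \<alpha> = {1, 2, 10 / 3, 6})"
proof (cases "distortion_error dyadic_P \<alpha> = \<top>")
  case True
  then show ?thesis
    by (simp add: top_unique)
next
  case False
  have "\<alpha> \<noteq> {}"
    using \<alpha> by auto
  define D where "D x = (\<lambda>a. \<bar>x - a\<bar>\<^sup>2) ` \<alpha>" for x :: real
  have "\<forall>k. \<exists>a\<in>\<alpha>. Min (D (real k + 1)) = (real k + 1 - a)\<^sup>2"
  proof
    fix k
    have "Min (D (real k + 1)) \<in> D (real k + 1)"
      using \<alpha> \<open>\<alpha> \<noteq> {}\<close> by (intro Min_in) (auto simp: D_def)
    then show "\<exists>a\<in>\<alpha>. Min (D (real k + 1)) = (real k + 1 - a)\<^sup>2"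
      by (auto simp: D_def)
  qed
  \<comment> \<open>Ties may be broken arbitrarily: \<open>nearest_point_mono\<close> makes any
    choice of nearest points monotone.\<close>
  then obtain N where N\<alpha>: "\<And>k. N k \<in> \<alpha>"
    and N: "\<And>k. Min (D (real k + 1)) = (real k + 1 - N k)\<^sup>2"
    by metis
  have nearest: "(real k + 1 - N k)\<^sup>2 \<le> (real k + 1 - a)\<^sup>2" if "a \<in> \<alpha>" for a k
    unfolding N[symmetric] using \<alpha> that by (intro Min_le) (auto simp: D_def)
  have "mono N"
  proof (rule monoI)
    fix i j :: nat
    assume "i \<le> j"
    then show "N i \<le> N j"
      by (cases "i = j")
        (use nearest[OF N\<alpha>] in \<open>auto intro: nearest_point_mono[of "real i + 1" "real j + 1"]\<close>)
  qed
  have sub: "range N \<subseteq> \<alpha>"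
    using N\<alpha> by auto
  then have fin: "finite (range N)" "card (range N) \<le> 4"
    using \<alpha> card_mono[OF \<alpha>(1) sub] by (auto intro: finite_subset)
  define f where "f k = atom_mass k * (real k + 1 - N k)\<^sup>2" for k
  have nonneg: "0 \<le> f k" for k
    by (simp add: f_def atom_mass_pos less_imp_le)
  have dist: "distortion_error dyadic_P \<alpha> = (\<Sum>k. ennreal (f k))"
    using N by (simp add: distortion_error_dyadic_P[OF \<alpha>(1)] f_def D_def ennreal_mult'
        atom_mass_pos less_imp_le)
  have "summable f"
    using False nonneg unfolding dist by (intro summable_suminf_not_top) auto
  then have dist: "distortion_error dyadic_P \<alpha> = ennreal (suminf f)"
    unfolding dist using nonneg by (intro suminf_ennreal2)
  have cost: "1 / 6 \<le> suminf f \<and> (suminf f \<le> 1 / 6 \<longrightarrow> {1, 2, 10 / 3, 6} \<subseteq> range N)"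
    using \<open>summable f\<close> by (intro assignment_cost \<open>mono N\<close> fin) (simp add: f_def[abs_def] summable_sums)
  \<comment> \<open>Four points forced into a set of at most four exhaust it.\<close>
  have "\<alpha> = {1, 2, 10 / 3, 6}" if "suminf f \<le> 1 / 6"
  proof -
    have "{1, 2, 10 / 3, 6} \<subseteq> \<alpha>"
      using cost that sub by blast
    then show ?thesis
      using \<alpha> by (intro card_seteq[symmetric]) auto
  qed
  with cost show ?thesis
    unfolding dist by simp
qed

lemma distortion_error_optimal_le: "distortion_error dyadic_P {1, 2, 10 / 3, 6} \<le> ennreal (1 / 6)"
proof -
  \<comment> \<open>Any assignment into the set bounds the minima from above; this one sends the
    blocks \<open>{1}\<close>, \<open>{2}\<close>, \<open>{3, 4}\<close> and \<open>{5, ...}\<close>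
    to their means.\<close>
  define N :: "nat \<Rightarrow> real"
    where "N k = (if k = 0 then 1 else if k = 1 then 2 else if k \<le> 3 then 10 / 3 else 6)" for k
  define f where "f k = atom_mass k * (real k + 1 - N k)\<^sup>2" for k
  \<comment> \<open>The atom \<open>5 + k\<close> has mass \<open>1 / 2 ^ k / 32\<close> and
    deviation \<open>k - 1\<close> from \<open>6\<close>.\<close>
  have "(\<lambda>k. (real k - 1)\<^sup>2 / 2 ^ k / 32) sums ((4 + 2 * (1 - 1)\<^sup>2) / 32)"
    by (intro sums_divide geometric_second_moment_sums)
  then have "(\<lambda>k. f (k + 4)) sums (1 / 8)"
    by (simp add: f_def N_def atom_mass_add field_simps)
  then have "f sums (1 / 8 + (\<Sum>k<4. f k))"
    by (subst (asm) sums_iff_shift)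
  also have "1 / 8 + (\<Sum>k<4. f k) = 1 / 6"
    by (simp add: eval_nat_numeral f_def N_def atom_mass_def)
  finally have f: "f sums (1 / 6)" .
  have "distortion_error dyadic_P {1, 2, 10 / 3, 6} \<le> (\<Sum>k. ennreal (f k))"
  proof (subst distortion_error_dyadic_P, simp, rule suminf_le[OF _ summableI summableI])
    fix k
    have "Min ((\<lambda>a. \<bar>real k + 1 - a\<bar>\<^sup>2) ` {1, 2, 10 / 3, 6}) \<le> (real k + 1 - N k)\<^sup>2"
      by (intro Min_le) (auto simp: N_def)
    then show "ennreal (atom_mass k) *
        ennreal (Min ((\<lambda>a. \<bar>real k + 1 - a\<bar>\<^sup>2) ` {1, 2, 10 / 3, 6})) \<le> ennreal (f k)"
      unfolding f_def using atom_mass_pos[of k]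
      by (simp add: ennreal_mult' mult_left_mono ennreal_leI del: Min_insert)
  qed
  also have "\<dots> = ennreal (1 / 6)"
    by (rule suminf_ennreal_eq[OF _ f]) (simp add: f_def atom_mass_pos less_imp_le)
  finally show ?thesis .
qed

theorem proposition4p1p3:
  "(\<forall>\<alpha>. optimal_set_of_means dyadic_P 4 \<alpha> \<longleftrightarrow>
        \<alpha> = {1, 2, Av dyadic_P 3 4, Av_inf dyadic_P 5})
   \<and> quantization_error dyadic_P 4 = ennreal (1 / 6)"
proof -
  have opt: "distortion_error dyadic_P {1, 2, 10 / 3, 6} = ennreal (1 / 6)"
    using distortion_error_optimal_le distortion_error_lower_bound[of "{1, 2, 10 / 3, 6}"]
    by (intro antisym) auto
  have err: "quantization_error dyadic_P 4 = ennreal (1 / 6)"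
    unfolding quantization_error_def
  proof (rule antisym)
    show "(INF \<alpha>\<in>{\<alpha>. finite \<alpha> \<and> 1 \<le> card \<alpha> \<and> card \<alpha> \<le> 4}. distortion_error dyadic_P \<alpha>)
        \<le> ennreal (1 / 6)"
      by (rule INF_lower2[of "{1, 2, 10 / 3, 6}"]) (auto simp: opt)
  qed (auto intro!: INF_greatest dest: distortion_error_lower_bound)
  have "optimal_set_of_means dyadic_P 4 \<alpha> \<longleftrightarrow> \<alpha> = {1, 2, 10 / 3, 6}" for \<alpha>
    unfolding optimal_set_of_means_def err
    using distortion_error_lower_bound[of \<alpha>] opt by auto
  then show ?thesis
    by (simp add: Av_dyadic_P_3_4 Av_inf_dyadic_P_5 err)
qed

end
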